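(* Let $a$, $b$, $c$, and $k$ be positive integers with $k \geq 7$. Then the equation \[(a^2cx^k - 1)(b^2cy^k - 1) = (abcz^k - 1)^2\] has no solution in integers $x, y, z$ with $x > 1$, $y > 1$, $z > 1$ and $a^2x^k \neq b^2y^k$. *)

theory Defs
  imports Main
begin

end

(* Put X = a^2 c x^k > Y = b^2 c y^k, Z = a b c z^k, P = x y and Q = z^2. The equation gives
   X Y - Z^2 = X + Y - 2 Z > 0, so Q < P and (Q/P)^k = 1 - 1/Y + (2 Z - Y)/(X Y). Hence Q/P
   exceeds theta = (1 - 1/Y)^(1/k) only by O(P^(-k/2)), and comparison with Q/P <= 1 - 1/P gives
   P > k (Y - 1). Such good approximations are excluded by Thue's method: the diagonal Pade
   approximants A/B of w^(1/k) at w = 1 - 1/Y have an explicit positive remainder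
   A - theta B, and after multiplication by a small integer their values have integral
   coefficients. For a suitable degree A P - B Q, so scaled, becomes an integer strictly between
   0 and 1. Non-vanishing needs no determinant: the remainder is bounded below, and the
   approximation Q/P is too good to equal A/B. *)
theory Submission
  imports Defs "HOL-Analysis.Analysis" "HOL-Number_Theory.Cong"
begin

text \<open>The degree n is squeezed from two sides. The scaled form is forced below 1 once P < k (Y
  - 1) H^n, where H = 4 (Y - 1) / (k rho) and rho^n bounds the extra multiplier. Its sign is safe
  while the remainder, relative to the size of B at least of order 16^(-n) Y^(-2n-1), exceeds an
  error of order P^(-k/2). The least n meeting the first demand satisfies P >= k (Y - 1) H^(n-1).
  Hence the second demand follows if (k (Y - 1))^k exceeds a suitable multiple of Y^6, which settles
  degree 1, and if H^k >= 256 Y^4, which pays for each further degree. Both conditions rest on k >=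
  7. The only lower bound for Y is 2^k, and at Y = 2^7 the condition on H holds with little to
  spare. This is why the denominators of the coefficients are estimated through their prime factors:
  with rho = k the condition fails at Y = 2^k for k = 7, 8 and 9.\<close>

subsection \<open>Pade approximants of binomial powers\<close>

text \<open>\<open>pade n \<nu> w / pade n (-\<nu>) w\<close> is the diagonal Pade approximant of \<open>w powr \<nu>\<close> at \<open>w = 1\<close>.\<close>
definition pade :: "nat \<Rightarrow> real \<Rightarrow> real \<Rightarrow> real" where
  "pade n \<nu> w = (\<Sum>l\<le>n. (real n + \<nu> gchoose l) * (real n - \<nu> gchoose (n - l)) * w ^ l)"

text \<open>The normalisation of the remainder integral that turns its two polynomial parts into
  \<open>pade n \<nu>\<close> and \<open>pade n (-\<nu>)\<close>.\<close>
definition pade_const :: "nat \<Rightarrow> real \<Rightarrow> real" where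
  "pade_const n \<nu> = \<nu> * (\<Prod>i=1..n. 1 - \<nu>\<^sup>2 / real i ^ 2)"

text \<open>Pairing the factors nu - i and nu + i produces a run of 2n + 1 consecutive factors,
  which \<open>pade_coeff\<close> can then cut into pieces.\<close>

lemma pade_const_eq:
  "pade_const n \<nu> = (-1) ^ n * pochhammer (\<nu> - real n) (2 * n + 1) / fact n ^ 2"
proof (induction n)
  case 0
  then show ?case by (simp add: pade_const_def)
next
  case (Suc n)
  have "pochhammer (\<nu> - real (Suc n)) (2 * Suc n + 1)
      = pochhammer (\<nu> - real n - 1) (Suc (Suc (2 * n + 1)))" by (simp add: algebra_simps)
  also have "\<dots> = (\<nu> - real n - 1) * (pochhammer (\<nu> - real n) (2 * n + 1) * (\<nu> + real n + 1))"
    by (subst pochhammer_rec, subst pochhammer_Suc) (simp add: algebra_simps)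
  finally have *: "pochhammer (\<nu> - real (Suc n)) (2 * Suc n + 1)
      = (\<nu>\<^sup>2 - (real n + 1)\<^sup>2) * pochhammer (\<nu> - real n) (2 * n + 1)"
    by (simp add: power2_eq_square algebra_simps)
  have "pade_const (Suc n) \<nu> = pade_const n \<nu> * (1 - \<nu>\<^sup>2 / (real n + 1)\<^sup>2)"
    by (simp add: pade_const_def add.commute)
  also have "1 - \<nu>\<^sup>2 / (real n + 1)\<^sup>2 = - (\<nu>\<^sup>2 - (real n + 1)\<^sup>2) / (real n + 1)\<^sup>2"
    by (simp add: field_simps)
  finally show ?case unfolding Suc.IH * 
    by (simp add: power_mult_distrib add.commute del: of_nat_Suc) (simp add: field_simps)
qed

text \<open>Up to sign this is the n-th difference of 1/x. Pascal's rule gives f(x, n+1) = f(x, n) -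
  f(x+1, n), and the right-hand side obeys the same recurrence.\<close>

lemma alternating_binomial_partial_fractions:
  fixes x :: real
  assumes "\<And>i. i \<le> n \<Longrightarrow> x + real i \<noteq> 0"
  shows "(\<Sum>i\<le>n. (-1) ^ i * real (n choose i) / (x + real i)) = fact n / pochhammer x (n + 1)"
  using assms
proof (induction n arbitrary: x)
  case 0
  then show ?case by simp
next
  case (Suc n)
  define f where "f = (\<lambda>x n. \<Sum>i\<le>n. (-1) ^ i * real (n choose i) / (x + real i))"
  have "f x (Suc n) = 1 / x + (\<Sum>i\<le>n. (-1) ^ Suc i * real (Suc n choose Suc i) / (x + real (Suc i)))"
    unfolding f_def by (subst sum.atMost_Suc_shift) simp
  also have "\<dots> = 1 / x + (\<Sum>i\<le>n. (-1) ^ Suc i * real (n choose Suc i) / (x + real (Suc i)))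
      - f (x + 1) n"
    by (simp add: f_def sum_subtractf [symmetric] sum_negf [symmetric] sum.distrib [symmetric] add_divide_distrib
          diff_divide_distrib algebra_simps)
  also have "1 / x + (\<Sum>i\<le>n. (-1) ^ Suc i * real (n choose Suc i) / (x + real (Suc i)))
      = (\<Sum>i\<le>Suc n. (-1) ^ i * real (n choose i) / (x + real i))"
    by (subst sum.atMost_Suc_shift) simp
  also have "\<dots> = f x n" by (simp add: f_def)
  finally have rec: "f x (Suc n) = f x n - f (x + 1) n" .
  have nz: "x + real i \<noteq> 0" if "i \<le> Suc n" for i using Suc.prems that .
  have "x \<noteq> 0" using nz[of 0] by simp
  have p0: "pochhammer x (Suc n + 1) \<noteq> 0"
    using nz by (force simp: pochhammer_eq_0_iff eq_neg_iff_add_eq_0)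
  have a: "pochhammer x (Suc n + 1) = pochhammer x (n + 1) * (x + real n + 1)"
    by (simp add: pochhammer_Suc algebra_simps)
  have b: "pochhammer x (Suc n + 1) = x * pochhammer (x + 1) (n + 1)"
    by (simp add: pochhammer_rec)
  have ne: "pochhammer x (n + 1) \<noteq> 0" "x + real n + 1 \<noteq> 0" "pochhammer (x + 1) (n + 1) \<noteq> 0"
    using p0 a b by auto
  have "f x n = fact n / pochhammer x (n + 1)" unfolding f_def
    by (rule Suc.IH) (use nz in auto)
  also have "\<dots> = fact n * (x + real n + 1) / pochhammer x (Suc n + 1)"
    using ne p0 unfolding a by (simp add: field_simps)
  finally have 1: "f x n = fact n * (x + real n + 1) / pochhammer x (Suc n + 1)" .
  have "f (x + 1) n = fact n / pochhammer (x + 1) (n + 1)" unfolding f_def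
  proof (rule Suc.IH)
    fix i assume "i \<le> n" then show "x + 1 + real i \<noteq> 0" using nz[of "Suc i"] by (simp add: algebra_simps)
  qed
  also have "\<dots> = fact n * x / pochhammer x (Suc n + 1)"
    using ne p0 \<open>x \<noteq> 0\<close> unfolding b by (simp add: field_simps)
  finally have 2: "f (x + 1) n = fact n * x / pochhammer x (Suc n + 1)" .
  have "f x (Suc n) = fact n * (real n + 1) / pochhammer x (Suc n + 1)"
    unfolding rec 1 2 by (simp add: diff_divide_distrib [symmetric] algebra_simps)
  then show ?case unfolding f_def by (simp add: algebra_simps)
qed

lemma unit_interval_add_int_nonzero:
  fixes \<nu> :: real
  assumes "0 < \<nu>" "\<nu> < 1"
  shows "\<nu> + real_of_int m \<noteq> 0"
proof
  assume "\<nu> + real_of_int m = 0"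
  then have "real_of_int (-m) = \<nu>" by simp
  then have "0 < real_of_int (-m)" "real_of_int (-m) < 1" using assms by auto
  then have "0 < - m" "- m < 1" unfolding of_int_0_less_iff of_int_less_1_iff by simp_all
  then show False by simp
qed

text \<open>The factors of \<open>pade_const\<close>, running from nu - n to nu + n, split into
  blocks of lengths n - l, n + 1 and l. The middle block cancels the denominator; the outer two are
  the numerators of the generalised binomials.\<close>

lemma pade_coeff:
  fixes \<nu> :: real
  assumes \<nu>: "0 < \<nu>" "\<nu> < 1" and "l \<le> n"
  shows "pade_const n \<nu> * ((-1) ^ l * real (n choose l) * fact n / pochhammer (\<nu> - real l) (n + 1))
    = (real n + \<nu> gchoose l) * (real n - \<nu> gchoose (n - l))"
proof -
  define p1 p2 p3 where "p1 = pochhammer (\<nu> - real n) (n - l)"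
    and "p2 = pochhammer (\<nu> - real l) (n + 1)" and "p3 = pochhammer (\<nu> + real n - real l + 1) l"
  have "p2 \<noteq> 0" unfolding p2_def
  proof
    assume "pochhammer (\<nu> - real l) (n + 1) = 0"
    then obtain i where "\<nu> - real l = - real i" by (auto simp: pochhammer_eq_0_iff)
    then show False using unit_interval_add_int_nonzero[OF \<nu>, of "int i - int l"] by simp
  qed
  have "pochhammer (\<nu> - real n) (2 * n + 1) = pochhammer (\<nu> - real n) ((n - l) + ((n + 1) + l))"
    using \<open>l \<le> n\<close> by (intro arg_cong2[where f = pochhammer]) auto
  also have "\<dots> = p1 * (p2 * p3)"
    unfolding p1_def p2_def p3_def pochhammer_product' using \<open>l \<le> n\<close>
    by (simp add: of_nat_diff algebra_simps)
  finally have P: "pochhammer (\<nu> - real n) (2 * n + 1) = p1 * (p2 * p3)" .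
  have g1: "(real n + \<nu> gchoose l) = p3 / fact l"
    unfolding gbinomial_pochhammer' p3_def by (simp add: algebra_simps)
  have g2: "(real n - \<nu> gchoose (n - l)) = (-1) ^ (n - l) * p1 / fact (n - l)"
    unfolding gbinomial_pochhammer p1_def by simp
  have s: "(-1::real) ^ n * (-1) ^ l = (-1) ^ (n - l)"
    using \<open>l \<le> n\<close> by (metis le_add_diff_inverse2 left_minus_one_mult_self mult.commute power_add)
  have "pade_const n \<nu> * ((-1) ^ l * real (n choose l) * fact n / p2)
      = ((-1) ^ n * (-1) ^ l) * (p1 * p2 * p3 * real (n choose l) * fact n / (fact n ^ 2 * p2))"
    unfolding pade_const_eq P by simp
  also have "p1 * p2 * p3 * real (n choose l) * fact n / (fact n ^ 2 * p2)
     = p1 * p3 * (real (n choose l) / fact n)"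
    using \<open>p2 \<noteq> 0\<close> by (simp add: field_simps power2_eq_square)
  also have "real (n choose l) / fact n = 1 / (fact l * fact (n - l))"
    using \<open>l \<le> n\<close> by (simp add: binomial_fact)
  finally show ?thesis unfolding s g1 g2 p2_def by simp
qed

lemma has_integral_powr_unit:
  fixes w e :: real
  assumes "0 < w" "w \<le> 1" "e \<noteq> 0"
  shows "((\<lambda>u. u powr (e - 1)) has_integral (1 - w powr e) / e) {w..1}"
proof -
  have "((\<lambda>u. u powr (e - 1)) has_integral (1 powr e / e - w powr e / e)) {w..1}"
  proof (rule fundamental_theorem_of_calculus)
    fix x assume "x \<in> {w..1}"
    then have "x > 0" using assms by auto
    then have "((\<lambda>u. u powr e / e) has_real_derivative (x powr (e - 1))) (at x)"
      using assms by (auto intro!: derivative_eq_intros)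
    then show "((\<lambda>u. u powr e / e) has_vector_derivative (x powr (e - 1))) (at x within {w..1})"
      by (simp add: has_real_derivative_iff_has_vector_derivative has_vector_derivative_at_within)
  qed (use assms in auto)
  then show ?thesis by (simp add: diff_divide_distrib)
qed

text \<open>Expanding both n-th powers leaves only powers of u to integrate. The endpoint u = 1
  contributes a polynomial in w, the endpoint u = w contributes \<open>w powr \<nu>\<close> times a
  polynomial, and partial fractions evaluate the coefficients of both.\<close>

lemma pade_remainder_has_integral:
  fixes \<nu> w :: real
  assumes \<nu>: "0 < \<nu>" "\<nu> < 1" and w: "0 < w" "w \<le> 1"
  shows "((\<lambda>u. pade_const n \<nu> * ((1 - u) ^ n * (u - w) ^ n * u powr (\<nu> - real n - 1)))
     has_integral (pade n \<nu> w - w powr \<nu> * pade n (-\<nu>) w)) {w..1}"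
proof -
  define c where "c = (\<lambda>i j. (-1) ^ i * real (n choose i) * (real (n choose j) * (-w) ^ (n - j)))"
  define e where "e = (\<lambda>i j. \<nu> + real i + real j - real n)"
  have nz: "\<nu> + real_of_int m \<noteq> 0" for m by (rule unit_interval_add_int_nonzero[OF \<nu>])
  \<comment> \<open>As nu is not an integer, the power u^(-1) never occurs and no logarithm
    appears.\<close>
  have enz: "e i j \<noteq> 0" for i j using nz[of "int i + int j - int n"] by (simp add: e_def algebra_simps)
  have expand: "(1 - u) ^ n * (u - w) ^ n * u powr (\<nu> - real n - 1)
      = (\<Sum>i\<le>n. \<Sum>j\<le>n. c i j * u powr (e i j - 1))" if "u \<in> {w..1}" for u
  proof -
    have "u > 0" using that w by auto
    have "(1 - u) ^ n = (\<Sum>i\<le>n. (-1) ^ i * real (n choose i) * u ^ i)"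
      using binomial_ring[of "-u" 1 n]
      by (simp add: power_minus[of u] mult_ac)
    moreover have "(u - w) ^ n = (\<Sum>j\<le>n. real (n choose j) * (-w) ^ (n - j) * u ^ j)"
      using binomial_ring[of u "-w" n] by (simp add: mult_ac)
    ultimately have "(1 - u) ^ n * (u - w) ^ n * u powr (\<nu> - real n - 1)
       = ((\<Sum>i\<le>n. (-1) ^ i * real (n choose i) * u ^ i) * (\<Sum>j\<le>n. real (n choose j) * (-w) ^ (n - j) * u ^ j)) * u powr (\<nu> - real n - 1)"
      by simp
    also have "\<dots> = (\<Sum>i\<le>n. \<Sum>j\<le>n. ((-1) ^ i * real (n choose i) * u ^ i) * (real (n choose j) * (-w) ^ (n - j) * u ^ j) * u powr (\<nu> - real n - 1))"
      by (subst sum_product) (simp only: sum_distrib_right)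
    also have "\<dots> = (\<Sum>i\<le>n. \<Sum>j\<le>n. c i j * u powr (e i j - 1))"
    proof (intro sum.cong refl)
      fix i j
      have "u ^ i * u ^ j * u powr (\<nu> - real n - 1) = u powr (e i j - 1)"
        using \<open>u > 0\<close> by (simp add: e_def powr_realpow [symmetric] powr_add [symmetric] algebra_simps)
      from this [symmetric]
      show "((-1) ^ i * real (n choose i) * u ^ i) * (real (n choose j) * (-w) ^ (n - j) * u ^ j) * u powr (\<nu> - real n - 1)
         = c i j * u powr (e i j - 1)"
        by (simp only: c_def mult_ac)
    qed
    finally show ?thesis .
  qed
  have "((\<lambda>u. \<Sum>i\<le>n. \<Sum>j\<le>n. c i j * u powr (e i j - 1)) has_integral
      (\<Sum>i\<le>n. \<Sum>j\<le>n. c i j * ((1 - w powr e i j) / e i j))) {w..1}"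
    by (intro has_integral_sum has_integral_mult_right has_integral_powr_unit enz w) auto
  then have I: "((\<lambda>u. (1 - u) ^ n * (u - w) ^ n * u powr (\<nu> - real n - 1)) has_integral
      (\<Sum>i\<le>n. \<Sum>j\<le>n. c i j * ((1 - w powr e i j) / e i j))) {w..1}"
    by (rule has_integral_eq [rotated]) (simp add: expand)
  have "(\<Sum>i\<le>n. \<Sum>j\<le>n. c i j * ((1 - w powr e i j) / e i j))
     = (\<Sum>i\<le>n. \<Sum>j\<le>n. c i j / e i j) - (\<Sum>i\<le>n. \<Sum>j\<le>n. c i j * w powr e i j / e i j)"
    by (simp add: sum_subtractf [symmetric] diff_divide_distrib right_diff_distrib)
  moreover have "pade_const n \<nu> * (\<Sum>i\<le>n. \<Sum>j\<le>n. c i j / e i j) = pade n \<nu> w"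
  proof -
    have "(\<Sum>i\<le>n. \<Sum>j\<le>n. c i j / e i j) = (\<Sum>j\<le>n. \<Sum>i\<le>n. c i j / e i j)"
      by (rule sum.swap)
    \<comment> \<open>After reversing j, the outer index is the exponent of w, and the inner sum
      over i is a partial fraction sum.\<close>
    also have "\<dots> = (\<Sum>j\<le>n. \<Sum>i\<le>n. c i (n - j) / e i (n - j))"
      by (rule sum.reindex_bij_witness[of _ "\<lambda>j. n - j" "\<lambda>j. n - j"]) auto
    also have "\<dots> = (\<Sum>l\<le>n. ((-1) ^ l * real (n choose l) * fact n / pochhammer (\<nu> - real l) (n + 1)) * w ^ l)"
    proof (intro sum.cong refl)
      fix l assume "l \<in> {..n}"
      then have l: "l \<le> n" by simp
      have "(\<Sum>i\<le>n. c i (n - l) / e i (n - l))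
         = real (n choose l) * (-w) ^ l * (\<Sum>i\<le>n. (-1) ^ i * real (n choose i) / ((\<nu> - real l) + real i))"
        using l by (simp add: c_def e_def sum_distrib_left binomial_symmetric[OF l, symmetric] of_nat_diff algebra_simps)
      also have "(\<Sum>i\<le>n. (-1) ^ i * real (n choose i) / ((\<nu> - real l) + real i)) = fact n / pochhammer (\<nu> - real l) (n + 1)"
        by (rule alternating_binomial_partial_fractions) (use nz[of "int i - int l" for i] in \<open>simp add: algebra_simps\<close>)
      finally show "(\<Sum>i\<le>n. c i (n - l) / e i (n - l)) = ((-1) ^ l * real (n choose l) * fact n / pochhammer (\<nu> - real l) (n + 1)) * w ^ l"
        by (simp add: power_minus[of w] algebra_simps)
    qed
    finally have "pade_const n \<nu> * (\<Sum>i\<le>n. \<Sum>j\<le>n. c i j / e i j)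
       = (\<Sum>l\<le>n. (pade_const n \<nu> * ((-1) ^ l * real (n choose l) * fact n / pochhammer (\<nu> - real l) (n + 1))) * w ^ l)"
      by (simp only: sum_distrib_left mult.assoc)
    also have "\<dots> = pade n \<nu> w"
      unfolding pade_def by (intro sum.cong refl) (subst pade_coeff[OF \<nu>], auto)
    finally show ?thesis .
  qed
  moreover have "pade_const n \<nu> * (\<Sum>i\<le>n. \<Sum>j\<le>n. c i j * w powr e i j / e i j) = w powr \<nu> * pade n (-\<nu>) w"
  proof -
    have "(\<Sum>i\<le>n. \<Sum>j\<le>n. c i j * w powr e i j / e i j)
       = (\<Sum>i\<le>n. ((-1) ^ (n - i) * real (n choose (n - i)) * fact n / pochhammer (\<nu> - real (n - i)) (n + 1)) * (w powr \<nu> * w ^ i))"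
    proof (intro sum.cong refl)
      fix i assume "i \<in> {..n}"
      then have i: "i \<le> n" by simp
      have "(\<Sum>j\<le>n. c i j * w powr e i j / e i j)
         = (\<Sum>j\<le>n. ((-1) ^ (n - i) * real (n choose i) * (w powr \<nu> * w ^ i)) * ((-1) ^ j * real (n choose j) / ((\<nu> - real (n - i)) + real j)))"
      proof (intro sum.cong refl)
        fix j assume "j \<in> {..n}"
        then have j: "j \<le> n" by simp
        \<comment> \<open>The exponent at the endpoint w no longer depends on j, so here the sum
          over j is the partial fraction sum.\<close>
        have "w ^ (n - j) * w powr e i j = w powr \<nu> * w ^ i"
          using w j by (simp add: e_def powr_realpow [symmetric] powr_add [symmetric] of_nat_diff algebra_simps)
        moreover have "(-1::real) ^ i * (-1) ^ (n - j) = (-1) ^ (n - i) * (-1) ^ j"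
          using i j by (auto simp: uminus_power_if)
        moreover have "e i j = (\<nu> - real (n - i)) + real j"
          using i by (simp add: e_def of_nat_diff)
        moreover have "c i j * w powr e i j = ((-1) ^ i * (-1) ^ (n - j)) * real (n choose i) * real (n choose j) * (w ^ (n - j) * w powr e i j)"
          by (simp add: c_def power_minus[of w])
        ultimately show "c i j * w powr e i j / e i j = ((-1) ^ (n - i) * real (n choose i) * (w powr \<nu> * w ^ i)) * ((-1) ^ j * real (n choose j) / ((\<nu> - real (n - i)) + real j))"
          by (simp add: mult_ac)
      qed
      also have "\<dots> = ((-1) ^ (n - i) * real (n choose i) * (w powr \<nu> * w ^ i)) * (\<Sum>j\<le>n. (-1) ^ j * real (n choose j) / ((\<nu> - real (n - i)) + real j))"
        by (simp add: sum_distrib_left)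
      also have "(\<Sum>j\<le>n. (-1) ^ j * real (n choose j) / ((\<nu> - real (n - i)) + real j)) = fact n / pochhammer (\<nu> - real (n - i)) (n + 1)"
        by (rule alternating_binomial_partial_fractions) (use nz[of "int j - int (n - i)" for j] in \<open>simp add: algebra_simps\<close>)
      finally show "(\<Sum>j\<le>n. c i j * w powr e i j / e i j)
         = ((-1) ^ (n - i) * real (n choose (n - i)) * fact n / pochhammer (\<nu> - real (n - i)) (n + 1)) * (w powr \<nu> * w ^ i)"
        using i by (simp add: binomial_symmetric[OF i, symmetric])
    qed
    then have "pade_const n \<nu> * (\<Sum>i\<le>n. \<Sum>j\<le>n. c i j * w powr e i j / e i j)
      = (\<Sum>i\<le>n. (pade_const n \<nu> * ((-1) ^ (n - i) * real (n choose (n - i)) * fact n / pochhammer (\<nu> - real (n - i)) (n + 1))) * (w powr \<nu> * w ^ i))"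
      by (simp only: sum_distrib_left mult.assoc)
    \<comment> \<open>\<open>pade_coeff\<close> is applied at n - i: changing the sign of nu
      reverses the order of the coefficients.\<close>
    also have "\<dots> = (\<Sum>i\<le>n. ((real n + \<nu> gchoose (n - i)) * (real n - \<nu> gchoose i)) * (w powr \<nu> * w ^ i))"
      by (intro sum.cong refl) (subst pade_coeff[OF \<nu>], auto)
    finally show ?thesis unfolding pade_def by (simp add: sum_distrib_left mult_ac)
  qed
  ultimately show ?thesis using has_integral_mult_right[OF I, of "pade_const n \<nu>"]
    by (simp add: right_diff_distrib)
qed

section \<open>Bounds for the remainder and for the approximants\<close>

lemma pade_const_bounds:
  fixes \<nu> :: real
  assumes "0 < \<nu>" "\<nu> \<le> 1 / 2"
  shows "\<nu> / 2 \<le> pade_const n \<nu>" "pade_const n \<nu> \<le> \<nu>"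
proof -
  \<comment> \<open>Since nu <= 1/2 <= i / (i + 1), each factor is at least 1 - 1 / (i + 1)^2, and
    the product of these telescopes to (n + 2) / (2 (n + 1)).\<close>
  have fac: "1 - \<nu>\<^sup>2 / real (Suc n) ^ 2 \<ge> 1 - 1 / real (Suc (Suc n)) ^ 2"
            "1 - \<nu>\<^sup>2 / real (Suc n) ^ 2 \<le> 1" for n
  proof -
    have "\<nu> * real (Suc (Suc n)) \<le> 1 / 2 * real (Suc (Suc n))"
      using assms by (intro mult_right_mono) auto
    also have "\<dots> \<le> real (Suc n)" by simp
    finally have "(\<nu> * real (Suc (Suc n)))\<^sup>2 \<le> real (Suc n) ^ 2"
      using assms by (intro power_mono) auto
    then show "1 - \<nu>\<^sup>2 / real (Suc n) ^ 2 \<ge> 1 - 1 / real (Suc (Suc n)) ^ 2"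
      by (simp add: power_mult_distrib divide_simps del: of_nat_Suc) (simp add: algebra_simps del: of_nat_Suc)
  qed simp
  have "(\<Prod>i=1..n. 1 - \<nu>\<^sup>2 / real i ^ 2) \<ge> (real n + 2) / (2 * (real n + 1)) \<and>
        (\<Prod>i=1..n. 1 - \<nu>\<^sup>2 / real i ^ 2) \<le> 1"
  proof (induction n)
    case (Suc n)
    define p where "p = (\<Prod>i=1..n. 1 - \<nu>\<^sup>2 / real i ^ 2)"
    have p: "(\<Prod>i=1..Suc n. 1 - \<nu>\<^sup>2 / real i ^ 2) = p * (1 - \<nu>\<^sup>2 / real (Suc n) ^ 2)"
      by (simp add: p_def)
    have IH: "p \<ge> (real n + 2) / (2 * (real n + 1))" "p \<le> 1" using Suc by (auto simp: p_def)
    have p0: "p \<ge> 0" using IH(1) by (rule order.trans[rotated]) simp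
    have f0: "1 - 1 / real (Suc (Suc n)) ^ 2 \<ge> 0" by (simp add: divide_simps)
    have "p * (1 - \<nu>\<^sup>2 / real (Suc n) ^ 2) \<ge> (real n + 2) / (2 * (real n + 1)) * (1 - 1 / real (Suc (Suc n)) ^ 2)"
      by (rule mult_mono[OF IH(1) fac(1) p0 f0])
    also have "(real n + 2) / (2 * (real n + 1)) * (1 - 1 / real (Suc (Suc n)) ^ 2) = (real (Suc n) + 2) / (2 * (real (Suc n) + 1))"
    proof -
      have *: "(x + 2) / (2 * (x + 1)) * (1 - 1 / (x + 2)\<^sup>2) = (x + 3) / (2 * (x + 2))"
        if "x \<ge> 0" for x :: real
      proof -
        have "1 - 1 / (x + 2)\<^sup>2 = (x + 1) * (x + 3) / (x + 2)\<^sup>2"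
          using that by (simp add: divide_simps) (simp add: algebra_simps power2_eq_square)
        then show ?thesis using that by (simp add: divide_simps) (simp add: power2_eq_square algebra_simps)
      qed
      show ?thesis using *[of "real n"] by (simp add: add_ac)
    qed
    finally show ?case unfolding p using mult_mono[OF IH(2) fac(2)[of n] _ order.trans[OF f0 fac(1)]] by simp
  qed simp
  moreover have "(real n + 2) / (2 * (real n + 1)) \<ge> 1 / 2" by (simp add: field_simps)
  ultimately have P: "1 / 2 \<le> (\<Prod>i=1..n. 1 - \<nu>\<^sup>2 / real i ^ 2)" "(\<Prod>i=1..n. 1 - \<nu>\<^sup>2 / real i ^ 2) \<le> 1" by linarith+
  show "\<nu> / 2 \<le> pade_const n \<nu>" "pade_const n \<nu> \<le> \<nu>" unfolding pade_const_def
    using mult_left_mono[OF P(1), of \<nu>] mult_left_mono[OF P(2), of \<nu>] assms by auto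
qed

text \<open>A Beta integral rescaled to the interval from w to 1. Integration by parts moves one
  factor from 1 - u to u - w; the boundary terms vanish.\<close>

lemma has_integral_beta_interval:
  fixes w :: real
  assumes "w \<le> 1"
  shows "((\<lambda>u. (1 - u) ^ m * (u - w) ^ n) has_integral
     ((1 - w) ^ (m + n + 1) * fact m * fact n / fact (m + n + 1))) {w..1}"
proof (induction m arbitrary: n)
  case 0
  have "((\<lambda>u. (u - w) ^ n) has_integral ((1 - w) ^ Suc n / real (Suc n) - (w - w) ^ Suc n / real (Suc n))) {w..1}"
  proof (rule fundamental_theorem_of_calculus)
    fix x
    have "((\<lambda>u. (u - w) ^ Suc n / real (Suc n)) has_real_derivative ((x - w) ^ n)) (at x)"
      by (auto intro!: derivative_eq_intros simp del: of_nat_Suc power_Suc)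
    then show "((\<lambda>u. (u - w) ^ Suc n / real (Suc n)) has_vector_derivative ((x - w) ^ n)) (at x within {w..1})"
      by (simp add: has_real_derivative_iff_has_vector_derivative has_vector_derivative_at_within)
  qed (use assms in auto)
  moreover have "(1 - w) ^ Suc n / real (Suc n) = (1 - w) ^ Suc n * fact n / fact (Suc n)"
    by (simp add: fact_Suc del: of_nat_Suc power_Suc)
  ultimately show ?case by (simp add: mult_ac)
next
  case (Suc m)
  have "((\<lambda>u. real (Suc n) * ((1 - u) ^ Suc m * (u - w) ^ n) - real (Suc m) * ((1 - u) ^ m * (u - w) ^ Suc n)) has_integral
     ((1 - 1) ^ Suc m * (1 - w) ^ Suc n - (1 - w) ^ Suc m * (w - w) ^ Suc n)) {w..1}"
  proof (rule fundamental_theorem_of_calculus)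
    fix x
    have "((\<lambda>u. (1 - u) ^ Suc m * (u - w) ^ Suc n) has_real_derivative
      (real (Suc n) * ((1 - x) ^ Suc m * (x - w) ^ n) - real (Suc m) * ((1 - x) ^ m * (x - w) ^ Suc n))) (at x)"
      by (rule derivative_eq_intros refl)+ (simp del: of_nat_Suc power_Suc)
    then show "((\<lambda>u. (1 - u) ^ Suc m * (u - w) ^ Suc n) has_vector_derivative
      (real (Suc n) * ((1 - x) ^ Suc m * (x - w) ^ n) - real (Suc m) * ((1 - x) ^ m * (x - w) ^ Suc n))) (at x within {w..1})"
      by (simp only: has_real_derivative_iff_has_vector_derivative has_vector_derivative_at_within)
  qed (use assms in auto)
  from has_integral_add[OF this has_integral_mult_right[OF Suc.IH[of "Suc n"], of "real (Suc m)"]]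
  have "((\<lambda>u. real (Suc n) * ((1 - u) ^ Suc m * (u - w) ^ n)) has_integral
     (real (Suc m) * ((1 - w) ^ (m + Suc n + 1) * fact m * fact (Suc n) / fact (m + Suc n + 1)))) {w..1}"
    by (simp del: of_nat_Suc)
  from has_integral_mult_right[OF this, of "1 / real (Suc n)"]
  have "((\<lambda>u. (1 - u) ^ Suc m * (u - w) ^ n) has_integral
     (real (Suc m) / real (Suc n) * ((1 - w) ^ (m + Suc n + 1) * fact m * fact (Suc n) / fact (m + Suc n + 1)))) {w..1}"
    by (simp add: mult.assoc [symmetric] del: of_nat_Suc power_Suc fact_Suc)
  moreover have "m + Suc n + 1 = Suc m + n + 1" by simp
  ultimately show ?case
    unfolding fact_Suc [of m] fact_Suc [of n] by (simp add: mult_ac del: of_nat_Suc fact_Suc power_Suc)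
qed

text \<open>The quotient (1 - u) (u - w) / u is maximal at u = sqrt w, with value (1 - sqrt w)^2.
  Extracting its n-th power leaves \<open>u powr (\<nu> - 1)\<close>, whose integral is
  explicit.\<close>

lemma pade_remainder_le:
  fixes \<nu> w :: real
  assumes \<nu>: "0 < \<nu>" "\<nu> \<le> 1 / 2" and w: "0 < w" "w \<le> 1"
  shows "pade n \<nu> w - w powr \<nu> * pade n (-\<nu>) w \<le> (1 - sqrt w) ^ (2 * n) * (1 - w powr \<nu>)"
proof -
  have "((\<lambda>u. (\<nu> * (1 - sqrt w) ^ (2 * n)) * u powr (\<nu> - 1)) has_integral
      ((\<nu> * (1 - sqrt w) ^ (2 * n)) * ((1 - w powr \<nu>) / \<nu>))) {w..1}"
    using \<nu> w by (intro has_integral_mult_right has_integral_powr_unit) auto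
  then have I: "((\<lambda>u. (\<nu> * (1 - sqrt w) ^ (2 * n)) * u powr (\<nu> - 1)) has_integral
      ((1 - sqrt w) ^ (2 * n) * (1 - w powr \<nu>))) {w..1}"
    using \<nu> by simp
  show ?thesis
  proof (rule has_integral_le[OF pade_remainder_has_integral I])
    fix u assume "u \<in> {w..1}"
    then have u: "w \<le> u" "u \<le> 1" "u > 0" using w by auto
    have "0 \<le> (u - sqrt w)\<^sup>2" by simp
    then have "2 * u * sqrt w \<le> u\<^sup>2 + w" using w by (simp add: power2_diff mult_ac)
    then have "(1 - u) * (u - w) \<le> (1 - sqrt w)\<^sup>2 * u"
      using w by (simp add: power2_diff algebra_simps power2_eq_square)
    then have "((1 - u) * (u - w)) ^ n \<le> ((1 - sqrt w)\<^sup>2 * u) ^ n"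
      using u by (intro power_mono) auto
    then have "(1 - u) ^ n * (u - w) ^ n * u powr (\<nu> - real n - 1) \<le> ((1 - sqrt w)\<^sup>2 * u) ^ n * u powr (\<nu> - real n - 1)"
      by (intro mult_right_mono) (auto simp: power_mult_distrib)
    also have "\<dots> = (1 - sqrt w) ^ (2 * n) * (u ^ n * u powr (\<nu> - real n - 1))"
      by (simp add: power_mult_distrib power_mult)
    also have "u ^ n * u powr (\<nu> - real n - 1) = u powr (\<nu> - 1)"
      using u by (simp add: powr_realpow [symmetric] powr_add [symmetric] algebra_simps)
    finally have "(1 - u) ^ n * (u - w) ^ n * u powr (\<nu> - real n - 1) \<le> (1 - sqrt w) ^ (2 * n) * u powr (\<nu> - 1)" .
    then have "pade_const n \<nu> * ((1 - u) ^ n * (u - w) ^ n * u powr (\<nu> - real n - 1)) \<le> \<nu> * ((1 - sqrt w) ^ (2 * n) * u powr (\<nu> - 1))"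
      by (rule mult_mono[OF pade_const_bounds(2)[OF \<nu>]]) (use u \<nu> in simp_all)
    then show "pade_const n \<nu> * ((1 - u) ^ n * (u - w) ^ n * u powr (\<nu> - real n - 1)) \<le> \<nu> * (1 - sqrt w) ^ (2 * n) * u powr (\<nu> - 1)"
      by (simp add: mult.assoc)
  qed (use \<nu> w in auto)
qed

text \<open>The exponent of u is negative and u <= 1, so dropping that power only decreases the
  integrand and leaves a Beta integral.\<close>

lemma pade_remainder_ge:
  fixes \<nu> w :: real
  assumes \<nu>: "0 < \<nu>" "\<nu> \<le> 1 / 2" and w: "0 < w" "w \<le> 1"
  shows "\<nu> / 2 * (1 - w) ^ (2 * n + 1) / (real (2 * n + 1) * real (2 * n choose n))
    \<le> pade n \<nu> w - w powr \<nu> * pade n (-\<nu>) w"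
proof -
  have "((\<lambda>u. \<nu> / 2 * ((1 - u) ^ n * (u - w) ^ n)) has_integral
     (\<nu> / 2 * ((1 - w) ^ (n + n + 1) * fact n * fact n / fact (n + n + 1)))) {w..1}"
    using w by (intro has_integral_mult_right has_integral_beta_interval) auto
  moreover have "\<nu> / 2 * ((1 - w) ^ (n + n + 1) * fact n * fact n / fact (n + n + 1))
      = \<nu> / 2 * (1 - w) ^ (2 * n + 1) / (real (2 * n + 1) * real (2 * n choose n))"
  proof -
    have e: "n + n + 1 = 2 * n + 1" "2 * n - n = n" "n \<le> 2 * n" by simp_all
    have c: "real (2 * n choose n) = fact (2 * n) / (fact n * fact n)"
      using binomial_fact[OF e(3), where 'a = real] unfolding e(2) .
    have f: "fact (2 * n + 1) = real (2 * n + 1) * fact (2 * n)" by simp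
    show ?thesis unfolding e(1) c f by (simp del: of_nat_add of_nat_mult)
  qed
  ultimately have I: "((\<lambda>u. \<nu> / 2 * ((1 - u) ^ n * (u - w) ^ n)) has_integral
     (\<nu> / 2 * (1 - w) ^ (2 * n + 1) / (real (2 * n + 1) * real (2 * n choose n)))) {w..1}"
    by (rule back_subst)
  show ?thesis
  proof (rule has_integral_le[OF I pade_remainder_has_integral])
    fix u assume "u \<in> {w..1}"
    then have u: "w \<le> u" "u \<le> 1" "u > 0" using w by auto
    have "1 powr (\<nu> - real n - 1) \<le> u powr (\<nu> - real n - 1)"
      by (rule powr_mono2') (use u \<nu> in auto)
    then have "(1 - u) ^ n * (u - w) ^ n * 1 \<le> (1 - u) ^ n * (u - w) ^ n * u powr (\<nu> - real n - 1)"
      using u by (intro mult_left_mono) auto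
    then show "\<nu> / 2 * ((1 - u) ^ n * (u - w) ^ n) \<le> pade_const n \<nu> * ((1 - u) ^ n * (u - w) ^ n * u powr (\<nu> - real n - 1))"
      by (intro mult_mono[OF pade_const_bounds(1)[OF \<nu>]])
         (use u \<nu> order.trans[OF _ pade_const_bounds(1)[OF \<nu>], of 0] in simp_all)
  qed (use \<nu> w in auto)
qed

lemma gbinomial_nonneg_real:
  fixes a :: real
  assumes "a \<ge> real k - 1"
  shows "a gchoose k \<ge> 0"
  unfolding gbinomial_prod_rev using assms by (intro divide_nonneg_nonneg prod_nonneg) auto

lemma pade_nonneg:
  fixes \<nu> w :: real
  assumes \<nu>: "-1 \<le> \<nu>" "\<nu> \<le> 1" and w: "0 \<le> w"
  shows "0 \<le> pade n \<nu> w"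
  unfolding pade_def using assms
  by (intro sum_nonneg mult_nonneg_nonneg gbinomial_nonneg_real zero_le_power) auto

text \<open>All coefficients are nonnegative, so w may be replaced by 1; Vandermonde's identity then
  removes nu.\<close>

lemma pade_le_central_binomial:
  fixes \<nu> w :: real
  assumes \<nu>: "-1 \<le> \<nu>" "\<nu> \<le> 1" and w: "0 \<le> w" "w \<le> 1"
  shows "pade n \<nu> w \<le> real (2 * n choose n)"
proof -
  have "pade n \<nu> w \<le> (\<Sum>l\<le>n. (real n + \<nu> gchoose l) * (real n - \<nu> gchoose (n - l)))"
    unfolding pade_def
  proof (rule sum_mono)
    fix l assume "l \<in> {..n}"
    then have "(real n + \<nu> gchoose l) * (real n - \<nu> gchoose (n - l)) \<ge> 0"
      using \<nu> by (intro mult_nonneg_nonneg gbinomial_nonneg_real) auto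
    moreover have "w ^ l \<le> 1" using w by (rule power_le_one)
    ultimately show "(real n + \<nu> gchoose l) * (real n - \<nu> gchoose (n - l)) * w ^ l \<le> (real n + \<nu> gchoose l) * (real n - \<nu> gchoose (n - l))"
      by (rule mult_left_le[rotated])
  qed
  also have "\<dots> = (real n + \<nu> + (real n - \<nu>)) gchoose n"
    unfolding atMost_atLeast0 by (rule gbinomial_Vandermonde)
  also have "real n + \<nu> + (real n - \<nu>) = real (2 * n)" by simp
  also have "real (2 * n) gchoose n = real (2 * n choose n)" by (simp only: binomial_gbinomial)
  finally show ?thesis .
qed

text \<open>The factor 2n + 1, absent from the cruder bound 4^n, absorbs the one in the denominator
  of \<open>pade_remainder_ge\<close>, so no factor polynomial in n survives.\<close>

lemma central_binomial_sq_le: "real (2 * n + 1) * real (2 * n choose n) ^ 2 \<le> 16 ^ n"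
proof (induction n)
  case (Suc n)
  define C where "C = real (2 * n choose n)"
  have C: "C = fact (2 * n) / fact n ^ 2" by (simp add: C_def binomial_fact mult_2 [symmetric] power2_eq_square)
  \<comment> \<open>The ratio of consecutive central binomial coefficients; the induction rests on
    (2n + 1) (2n + 3) <= 4 (n + 1)^2.\<close>
  define q where "q = 2 * (2 * real n + 1) / (real n + 1)"
  have e: "2 * Suc n - Suc n = Suc n" "Suc n \<le> 2 * Suc n" by simp_all
  have "real (2 * Suc n choose Suc n) = fact (2 * Suc n) / fact (Suc n) ^ 2"
    using binomial_fact[OF e(2), where 'a = real] unfolding e(1) power2_eq_square .
  also have "fact (2 * Suc n) = (2 * (real n + 1)) * (2 * real n + 1) * fact (2 * n)"
    by (simp add: algebra_simps)
  also have "fact (Suc n) = (real n + 1) * fact n" by (simp add: algebra_simps)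
  also have "2 * (real n + 1) * (2 * real n + 1) * fact (2 * n) / ((real n + 1) * fact n)\<^sup>2 = q * C"
    by (simp add: C q_def divide_simps) (simp add: power2_eq_square algebra_simps)
  finally have step: "real (2 * Suc n choose Suc n) = q * C" .
  have "q\<^sup>2 * (2 * real n + 3) = 4 * (2 * real n + 1) * ((2 * real n + 1) * (2 * real n + 3) / (real n + 1)\<^sup>2)"
    by (simp add: q_def power_divide power2_eq_square algebra_simps)
  also have "\<dots> \<le> 4 * (2 * real n + 1) * 4"
    by (intro mult_left_mono) (simp_all add: divide_simps, simp add: power2_eq_square algebra_simps)
  finally have q: "q\<^sup>2 * (2 * real n + 3) \<le> 16 * (2 * real n + 1)" by simp
  have "real (2 * Suc n + 1) * real (2 * Suc n choose Suc n) ^ 2 = (q\<^sup>2 * (2 * real n + 3)) * C\<^sup>2"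
    unfolding step by (simp add: power_mult_distrib)
  also have "\<dots> \<le> 16 * (2 * real n + 1) * C\<^sup>2"
    using q by (rule mult_right_mono) simp
  also have "\<dots> \<le> 16 * 16 ^ n" using Suc.IH by (simp add: C_def algebra_simps)
  finally show ?case by simp
qed simp

subsection \<open>Denominators of the coefficients\<close>

text \<open>With A = gcd N g, the full power in N of each prime dividing k goes into A, leaving none
  for B. The multiplier g then clears A, while B can be treated by inverting k.\<close>

lemma smooth_part_factorization:
  fixes N g k :: nat
  assumes "N > 0" "g > 0" and "\<And>p. prime p \<Longrightarrow> p dvd k \<Longrightarrow> multiplicity p N \<le> multiplicity p g"
  obtains A B where "N = A * B" "A dvd g" "coprime k B"
proof -
  define A B where "A = gcd N g" and "B = N div A"
  have N: "N = A * B" by (simp add: A_def B_def)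
  have "coprime k B"
  proof (rule ccontr)
    assume "\<not> coprime k B"
    then have "gcd k B \<noteq> 1" by (simp add: coprime_iff_gcd_eq_1)
    then obtain p where p: "prime p" "p dvd k" "p dvd B" using prime_factor_nat by (metis gcd_nat.boundedE)
    define v where "v = multiplicity p N"
    have "p ^ v dvd N" by (simp add: v_def multiplicity_dvd)
    moreover have "p ^ v dvd g" using assms(3)[OF p(1,2)] by (simp add: v_def multiplicity_dvd')
    ultimately have "p ^ v dvd A" by (simp add: A_def)
    then have "p ^ v * p dvd A * B" using p(3) by (rule mult_dvd_mono)
    then have "p ^ Suc v dvd N" by (simp add: N [symmetric] mult.commute)
    then have "Suc v \<le> multiplicity p N"
      using p(1) \<open>N > 0\<close> by (intro multiplicity_geI) auto
    then show False by (simp add: v_def)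
  qed
  moreover have "A dvd g" by (simp add: A_def)
  ultimately show thesis using N that by blast
qed

lemma fact_dvd_prod_diff: "fact l dvd (\<Prod>i<l. a - int i)"
  unfolding lessThan_atLeast0 gbinomial_int_mult_fact [symmetric] by (rule dvd_triv_left)

text \<open>Modulo an integer coprime to \<open>k\<close>, arithmetic progressions with difference \<open>k\<close>
  are rescaled runs of consecutive integers.\<close>
lemma dvd_prod_arith_progressions:
  fixes a b :: int and k l m B :: nat
  assumes "coprime k B" "int B dvd fact l * fact m"
  shows "int B dvd (\<Prod>i<l. a - int k * int i) * (\<Prod>i<m. b - int k * int i)"
proof -
  have "coprime (int k) (int B)" using assms(1) by simp
  then obtain j where j: "[int k * j = 1] (mod int B)" using cong_solve_coprime_int by blast
  have "[j * (c - int k * int i) = j * c - int i] (mod int B)" for c i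
  proof -
    have "[j * c - (int k * j) * int i = j * c - 1 * int i] (mod int B)"
      by (intro cong_diff cong_mult cong_refl j)
    then show ?thesis by (simp add: algebra_simps)
  qed
  then have "[(\<Prod>i<l. j * (a - int k * int i)) * (\<Prod>i<m. j * (b - int k * int i))
     = (\<Prod>i<l. j * a - int i) * (\<Prod>i<m. j * b - int i)] (mod int B)"
    by (intro cong_mult cong_prod)
  moreover have "int B dvd (\<Prod>i<l. j * a - int i) * (\<Prod>i<m. j * b - int i)"
    using assms(2) by (rule dvd_trans) (intro mult_dvd_mono fact_dvd_prod_diff)
  ultimately have "int B dvd (\<Prod>i<l. j * (a - int k * int i)) * (\<Prod>i<m. j * (b - int k * int i))"
    using cong_dvd_iff by blast
  then have d: "int B dvd j ^ (l + m) * ((\<Prod>i<l. a - int k * int i) * (\<Prod>i<m. b - int k * int i))"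
    by (simp add: prod.distrib power_add mult_ac)
  have "coprime (int k * j) (int B)" using j by (metis cong_imp_coprime cong_sym coprime_1_left)
  then have "coprime (int B) (j ^ (l + m))" by (simp add: coprime_commute)
  then show ?thesis using d by (simp add: coprime_dvd_mult_right_iff)
qed

text \<open>The power of k turns both binomials into products along progressions of difference k,
  divided by l! (n - l)!. Of this denominator, the part made of primes of k divides g and the part
  coprime to k divides the products.\<close>

lemma gbinomial_product_integral:
  fixes k g n l :: nat and e :: int
  assumes k: "k > 0" and g: "g > 0" and l: "l \<le> n"
    and mult: "\<And>p. prime p \<Longrightarrow> p dvd k \<Longrightarrow> multiplicity p (fact n :: nat) \<le> multiplicity p g"
  shows "real k ^ n * real g * ((real n + of_int e / real k gchoose l) * (real n - of_int e / real k gchoose (n - l))) \<in> \<int>"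
proof -
  define p1 p2 where "p1 = (\<Prod>i<l. (int k * int n + e) - int k * int i)"
    and "p2 = (\<Prod>i<n-l. (int k * int n - e) - int k * int i)"
  have gb: "real k ^ m * (of_int a / real k gchoose m) = of_int (\<Prod>i<m. a - int k * int i) / fact m" for a m
  proof -
    have "real k ^ m * (\<Prod>i = 0..<m. of_int a / real k - real i) = (\<Prod>i = 0..<m. real k * (of_int a / real k - real i))"
      by (simp add: prod.distrib)
    also have "\<dots> = (\<Prod>i = 0..<m. of_int a - real k * real i)"
      using k by (intro prod.cong) (auto simp: field_simps)
    finally show ?thesis by (simp add: gbinomial_prod_rev lessThan_atLeast0)
  qed
  \<comment> \<open>Because l! (n - l)! divides n!, one multiplier g serves every l.\<close>
  have "fact l * fact (n - l) dvd (fact n :: nat)"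
    using fact_fact_dvd_fact[of l "n - l", where 'a = nat] l by simp
  then have "multiplicity p (fact l * fact (n - l) :: nat) \<le> multiplicity p (fact n :: nat)" for p
    by (intro dvd_imp_multiplicity_le) auto
  then obtain A B where AB: "fact l * fact (n - l) = A * B" "A dvd g" "coprime k B"
    using smooth_part_factorization[of "fact l * fact (n - l)" g k] g mult
    by (metis fact_gt_zero nat_0_less_mult_iff order.trans)
  have ABi: "(fact l * fact (n - l) :: int) = int A * int B" using arg_cong[OF AB(1), of int] by simp
  have "int B dvd p1 * p2" unfolding p1_def p2_def
    by (rule dvd_prod_arith_progressions[OF AB(3)]) (simp add: ABi)
  then have "int A * int B dvd int g * (p1 * p2)" using AB(2) by (intro mult_dvd_mono) auto
  then obtain c where c: "int g * (p1 * p2) = (fact l * fact (n - l)) * c" unfolding ABi by (elim dvdE)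
  have kn: "real n + of_int e / real k = of_int (int k * int n + e) / real k"
      "real n - of_int e / real k = of_int (int k * int n - e) / real k"
    using k by (simp_all add: add_divide_distrib diff_divide_distrib)
  have "real k ^ n = real k ^ l * real k ^ (n - l)" using l by (simp add: power_add [symmetric])
  then have "real k ^ n * real g * ((real n + of_int e / real k gchoose l) * (real n - of_int e / real k gchoose (n - l)))
     = real g * ((real k ^ l * (of_int (int k * int n + e) / real k gchoose l)) * (real k ^ (n - l) * (of_int (int k * int n - e) / real k gchoose (n - l))))"
    unfolding kn by (simp only: mult_ac)
  also have "\<dots> = of_int (int g * (p1 * p2)) / (fact l * fact (n - l))"
    unfolding gb p1_def p2_def by simp
  also have "\<dots> = of_int c" unfolding c by simp
  finally show ?thesis by simp
qed

section \<open>Legendre's bound for the power of a prime in a factorial\<close>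

lemma multiplicity_fact_add_less:
  fixes p :: nat
  assumes "prime p" "r < p"
  shows "multiplicity p (fact (p * q + r) :: nat) = multiplicity p (fact (p * q) :: nat)"
  using assms(2)
proof (induction r)
  case (Suc r)
  have "\<not> p dvd Suc (p * q + r)"
  proof
    assume "p dvd Suc (p * q + r)"
    then have "p dvd Suc r" by (metis add_Suc_right dvd_add_right_iff dvd_triv_left)
    then show False using Suc.prems by (auto dest: dvd_imp_le)
  qed
  then have "multiplicity p (Suc (p * q + r) * fact (p * q + r) :: nat) = multiplicity p (fact (p * q + r) :: nat)"
    using assms(1) by (subst prime_elem_multiplicity_mult_distrib) (auto simp: not_dvd_imp_multiplicity_0)
  then show ?case using Suc by simp
qed simp

lemma multiplicity_fact_mult:
  fixes p :: nat
  assumes "prime p"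
  shows "multiplicity p (fact (p * q) :: nat) = q + multiplicity p (fact q :: nat)"
proof (induction q)
  case (Suc q)
  have "p > 0" using assms by (simp add: prime_gt_0_nat)
  have S: "multiplicity p (fact (Suc q) :: nat) = multiplicity p (Suc q) + multiplicity p (fact q :: nat)"
    unfolding fact_Suc of_nat_id using assms by (subst prime_elem_multiplicity_mult_distrib) auto
  have "multiplicity p (fact (p * Suc q) :: nat) = multiplicity p ((p * Suc q) * fact (p * q + (p - 1)) :: nat)"
    using \<open>p > 0\<close> fact_reduce[of "p * Suc q", where 'a = nat] by (simp add: algebra_simps)
  also have "\<dots> = multiplicity p (p * Suc q) + multiplicity p (fact (p * q + (p - 1)) :: nat)"
    using assms \<open>p > 0\<close> by (subst prime_elem_multiplicity_mult_distrib) auto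
  also have "multiplicity p (p * Suc q) = Suc (multiplicity p (Suc q))"
    using assms \<open>p > 0\<close> by (subst prime_elem_multiplicity_mult_distrib) auto
  also have "multiplicity p (fact (p * q + (p - 1)) :: nat) = multiplicity p (fact (p * q) :: nat)"
    using \<open>p > 0\<close> by (intro multiplicity_fact_add_less assms) simp
  finally show ?case using Suc.IH S by simp
qed simp

text \<open>With q = n div p, the multiplicity in n! is q plus that in q!, and (p - 1) q + q = p q
  <= n closes the induction.\<close>

lemma multiplicity_fact_le:
  fixes p :: nat
  assumes "prime p"
  shows "(p - 1) * multiplicity p (fact n :: nat) \<le> n"
proof (induction n rule: less_induct)
  case (less n)
  show ?case
  proof (cases "n = 0")
    case False
    have "p \<ge> 2" using assms by (simp add: prime_ge_2_nat)
    define q where "q = n div p"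
    have n: "p * q \<le> n" by (simp add: q_def)
    have "multiplicity p (fact n :: nat) = multiplicity p (fact (p * q + n mod p) :: nat)" by (simp add: q_def)
    also have "\<dots> = multiplicity p (fact (p * q) :: nat)"
      using \<open>p \<ge> 2\<close> by (intro multiplicity_fact_add_less assms) simp
    also have "\<dots> = q + multiplicity p (fact q :: nat)" by (rule multiplicity_fact_mult[OF assms])
    finally have "(p - 1) * multiplicity p (fact n :: nat) = (p - 1) * q + (p - 1) * multiplicity p (fact q :: nat)"
      by (simp add: algebra_simps)
    also have "(p - 1) * multiplicity p (fact q :: nat) \<le> q"
      by (rule less) (use False \<open>p \<ge> 2\<close> in \<open>simp add: q_def\<close>)
    also have "(p - 1) * q + q = p * q" using \<open>p \<ge> 2\<close> by (cases p) auto
    finally show ?thesis using n by linarith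
  qed simp
qed

text \<open>The multiplier \<open>g\<close> clears the primes of \<open>k\<close> from \<open>n!\<close>. For \<open>k = 7\<close> it is \<open>7 ^ (n div 6)\<close>, and
  the small values of \<open>\<rho>\<close> for \<open>k = 7, 8, 9\<close> are what the growth condition below needs.\<close>
lemma exists_fact_multiplier:
  fixes k :: nat
  assumes "k \<ge> 7"
  defines "\<rho> \<equiv> (if k \<le> 8 then 2 else if k = 9 then 3 else k)"
  shows "\<exists>g::nat. g > 0 \<and> g \<le> \<rho> ^ n \<and>
     (\<forall>p. prime p \<and> p dvd k \<longrightarrow> multiplicity p (fact n :: nat) \<le> multiplicity p g)"
proof -
  have v: "multiplicity p (fact n :: nat) \<le> n" if "prime p" for p
  proof -
    have "1 * multiplicity p (fact n :: nat) \<le> (p - 1) * multiplicity p (fact n :: nat)"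
      using prime_ge_2_nat[OF that] by (intro mult_right_mono) auto
    then show ?thesis using multiplicity_fact_le[OF that, of n] by linarith
  qed
  consider "k = 7" | "k > 7" using assms by linarith
  then show ?thesis
  proof cases
    case 1
    have p7: "prime (7::nat)" by simp
    have "6 * multiplicity 7 (fact n :: nat) \<le> n" using multiplicity_fact_le[OF p7, of n] by simp
    then have "multiplicity 7 (fact n :: nat) \<le> n div 6" by simp
    moreover have "(7::nat) ^ (n div 6) \<le> 2 ^ n"
    proof -
      have "(7::nat) ^ (n div 6) \<le> (2 ^ 6) ^ (n div 6)" by (intro power_mono) auto
      also have "\<dots> = 2 ^ (6 * (n div 6))" by (simp only: power_mult)
      also have "\<dots> \<le> 2 ^ n" by (intro power_increasing) auto
      finally show ?thesis .
    qed
    moreover have "multiplicity p (fact n :: nat) \<le> multiplicity p (7 ^ (n div 6))"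
      if "prime p \<and> p dvd 7" for p :: nat
    proof -
      have "p = 7" using that p7 primes_dvd_imp_eq by blast
      moreover have "multiplicity 7 ((7::nat) ^ (n div 6)) = n div 6"
        by (rule multiplicity_same_power) auto
      ultimately show ?thesis using \<open>multiplicity 7 _ \<le> n div 6\<close> by simp
    qed
    ultimately show ?thesis unfolding 1
      by (intro exI[of _ "7 ^ (n div 6)"] conjI allI impI) (auto simp: \<rho>_def 1)
  next
    case 2
    \<comment> \<open>For k > 7 the multiplier is \<open>\<rho> ^ n\<close>: every prime of k
      divides \<open>\<rho>\<close>, and no prime has multiplicity above n in n!.\<close>
    have r: "\<rho> > 0" "p dvd \<rho>" if "prime p" "p dvd k" for p
    proof -
      have "p dvd 2" if "k = 8" using \<open>prime p\<close> \<open>p dvd k\<close> that prime_dvd_power[of p 2 3] by simp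
      moreover have "p dvd 3" if "k = 9" using \<open>prime p\<close> \<open>p dvd k\<close> that prime_dvd_power[of p 3 2] by simp
      ultimately show "\<rho> > 0" "p dvd \<rho>" using 2 that by (auto simp: \<rho>_def)
    qed
    have "\<rho> > 0" using 2 by (auto simp: \<rho>_def)
    have "multiplicity p (fact n :: nat) \<le> multiplicity p (\<rho> ^ n)" if "prime p" "p dvd k" for p
    proof -
      have "p ^ n dvd \<rho> ^ n" using r(2)[OF that] by (rule dvd_power_same)
      then have "n \<le> multiplicity p (\<rho> ^ n)"
        using that(1) \<open>\<rho> > 0\<close> by (intro multiplicity_geI) auto
      then show ?thesis using v[OF that(1)] by linarith
    qed
    then show ?thesis using \<open>\<rho> > 0\<close> by (intro exI[of _ "\<rho> ^ n"]) auto
  qed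
qed

subsection \<open>Excluding good rational approximations\<close>

text \<open>The numerator e is kept general so that, with e = 1 and e = -1, one factor clears both
  approximants.\<close>

lemma pade_clear_denominators:
  fixes k g n :: nat and e Y :: int
  assumes k: "k > 0" and g: "g > 0" and Y: "Y \<noteq> 0"
    and mult: "\<And>p. prime p \<Longrightarrow> p dvd k \<Longrightarrow> multiplicity p (fact n :: nat) \<le> multiplicity p g"
  shows "real k ^ n * real g * of_int Y ^ n * pade n (of_int e / real k) (1 - 1 / of_int Y) \<in> \<int>"
proof -
  define c where "c = (\<lambda>l. (real n + of_int e / real k gchoose l) * (real n - of_int e / real k gchoose (n - l)))"
  have "real k ^ n * real g * of_int Y ^ n * pade n (of_int e / real k) (1 - 1 / of_int Y)
     = (\<Sum>l\<le>n. (real k ^ n * real g * c l) * (of_int Y ^ n * (1 - 1 / of_int Y) ^ l))"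
    unfolding pade_def c_def by (simp only: sum_distrib_left mult_ac)
  also have "\<dots> \<in> \<int>"
  proof (intro Ints_sum Ints_mult[of "real k ^ n * real g * c _"])
    fix l assume "l \<in> {..n}"
    then have l: "l \<le> n" by simp
    show "real k ^ n * real g * c l \<in> \<int>"
      unfolding c_def by (rule gbinomial_product_integral[OF k g l mult])
    have "(of_int Y ^ n :: real) = of_int Y ^ l * of_int Y ^ (n - l)" using l by (simp add: power_add [symmetric])
    then have "of_int Y ^ n * (1 - 1 / of_int Y) ^ l = (of_int Y * (1 - 1 / of_int Y)) ^ l * (of_int Y ^ (n - l) :: real)"
      by (simp only: power_mult_distrib mult_ac)
    also have "of_int Y * (1 - 1 / of_int Y) = (of_int (Y - 1) :: real)" using Y by (simp add: field_simps)
    finally show "of_int Y ^ n * (1 - 1 / of_int Y) ^ l \<in> (\<int> :: real set)" by simp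
  qed
  finally show ?thesis .
qed

section \<open>Elementary inequalities and the contradiction for a good approximation\<close>

lemma two_power_ge_eight_squares: "k \<ge> 10 \<Longrightarrow> 8 * k\<^sup>2 \<le> 2 ^ k" for k :: nat
proof (induction k rule: dec_induct)
  case (step k)
  have "8 * (Suc k)\<^sup>2 \<le> 2 * (8 * k\<^sup>2)"
  proof -
    have "3 * k \<le> k\<^sup>2" using step(1) unfolding power2_eq_square by (intro mult_right_mono) auto
    moreover have "(Suc k)\<^sup>2 = k\<^sup>2 + 2 * k + 1" by (simp add: power2_eq_square)
    ultimately show ?thesis using step(1) by linarith
  qed
  then show ?case using step by simp
qed simp

text \<open>With N = Y this says that raising the degree by one, which multiplies the lower bound
  for P^k by H^k, outweighs the square of the factor 16 Y^2 lost by the remainder.\<close>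

lemma growth_condition:
  fixes k :: nat and N :: real
  assumes "k \<ge> 7" and N: "N \<ge> 2 ^ k"
  defines "\<rho> \<equiv> (if k \<le> 8 then 2 else if k = 9 then 3 else k)"
  shows "256 * N ^ 4 \<le> (4 * (N - 1) / (real k * real \<rho>)) ^ k"
proof -
  \<comment> \<open>If H >= c N, then N^4 cancels and the remaining N^(k-4) is smallest at N = 2^k,
    which leaves a numerical condition on c.\<close>
  have red: ?thesis if c: "c \<ge> 0" "c * N \<le> 4 * (N - 1) / (real k * real \<rho>)" "256 \<le> (c * 2 ^ (k - 4)) ^ k" for c
  proof -
    have "N > 0" using N by (rule less_le_trans[rotated]) simp
    have "256 * N ^ 4 \<le> (c * 2 ^ (k - 4)) ^ k * N ^ 4" using c by (intro mult_right_mono) auto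
    also have "\<dots> = c ^ k * ((2 ^ k) ^ (k - 4) * N ^ 4)"
      by (simp add: power_mult_distrib power_mult [symmetric] mult.commute)
    also have "\<dots> \<le> c ^ k * (N ^ (k - 4) * N ^ 4)"
      using c N by (intro mult_left_mono mult_right_mono power_mono) auto
    also have "\<dots> = (c * N) ^ k" using assms(1) by (simp add: power_mult_distrib power_add [symmetric])
    also have "\<dots> \<le> (4 * (N - 1) / (real k * real \<rho>)) ^ k"
      using c \<open>N > 0\<close> by (intro power_mono) auto
    finally show ?thesis .
  qed
  consider "k = 7" | "k = 8" | "k = 9" | "k \<ge> 10" using assms by linarith
  then show ?thesis
  proof cases
    case 1
    \<comment> \<open>Here and in the next two cases c is 4 (1 - 2^(-k)) / (k rho), the value of H /
      N at N = 2^k.\<close>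
    show ?thesis by (rule red[of "127 / 448"]) (use 1 N in \<open>auto simp: \<rho>_def field_simps\<close>)
  next
    case 2
    show ?thesis by (rule red[of "255 / 1024"]) (use 2 N in \<open>auto simp: \<rho>_def field_simps\<close>)
  next
    case 3
    show ?thesis by (rule red[of "4 * 511 / (27 * 512)"]) (use 3 N in \<open>auto simp: \<rho>_def field_simps\<close>)
  next
    case 4
    have "(2::real) ^ 10 \<le> 2 ^ k" using 4 by (intro power_increasing) auto
    then have N10: "N \<ge> 1024" using N by simp
    have k2: "real k ^ 2 > 0" using 4 by simp
    have "real (8 * k\<^sup>2) \<le> real (2 ^ k)" using two_power_ge_eight_squares[OF 4] by (simp only: of_nat_le_iff)
    then have "8 * real k ^ 2 \<le> 2 ^ k" by simp
    also have "(2::real) ^ k = 2 ^ (4 + (k - 4))" using 4 by simp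
    also have "\<dots> = 16 * 2 ^ (k - 4)" by (subst power_add) simp
    finally have k: "real k ^ 2 \<le> 2 * 2 ^ (k - 4)" by simp
    show ?thesis
    proof (rule red[of "4 * (1023 / 1024) / real k ^ 2"])
      have "4 * (1023 / 1024) / real k ^ 2 * N = (4 * (1023 / 1024) * N) / real k ^ 2" by simp
      also have "\<dots> \<le> (4 * (N - 1)) / real k ^ 2"
        using N10 by (intro divide_right_mono) auto
      also have "\<dots> = 4 * (N - 1) / (real k * real \<rho>)" using 4 by (simp add: \<rho>_def power2_eq_square)
      finally show "4 * (1023 / 1024) / real k ^ 2 * N \<le> 4 * (N - 1) / (real k * real \<rho>)" .
      have "2 * (1023 / 1024) \<le> 4 * (1023 / 1024) / real k ^ 2 * 2 ^ (k - 4)"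
        using k k2 by (simp add: field_simps)
      then have "(2 * (1023 / 1024)) ^ k \<le> (4 * (1023 / 1024) / real k ^ 2 * 2 ^ (k - 4)) ^ k"
        by (intro power_mono) auto
      moreover have "(2 * (1023 / 1024)) ^ 10 \<le> (2 * (1023 / 1024) :: real) ^ k"
        using 4 by (intro power_increasing) auto
      moreover have "256 \<le> (2 * (1023 / 1024) :: real) ^ 10" by (simp add: power_divide)
      ultimately show "256 \<le> (4 * (1023 / 1024) / real k ^ 2 * 2 ^ (k - 4)) ^ k" by linarith
    qed simp
  qed
qed

text \<open>A mean value estimate without derivatives; it turns closeness of k-th powers into
  closeness of the numbers themselves.\<close>

lemma power_diff_ge:
  fixes a b :: real
  assumes "0 \<le> b" "b \<le> a"
  shows "real k * b ^ (k - 1) * (a - b) \<le> a ^ k - b ^ k"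
proof -
  have "real k * b ^ (k - 1) = (\<Sum>i<k. b ^ (k - 1))" by simp
  also have "\<dots> \<le> (\<Sum>i<k. b ^ (k - Suc i) * a ^ i)"
  proof (rule sum_mono)
    fix i assume "i \<in> {..<k}"
    then have "b ^ (k - 1) = b ^ (k - Suc i) * b ^ i" by (simp add: power_add [symmetric])
    also have "\<dots> \<le> b ^ (k - Suc i) * a ^ i" using assms by (intro mult_left_mono power_mono) auto
    finally show "b ^ (k - 1) \<le> b ^ (k - Suc i) * a ^ i" .
  qed
  finally have "(a - b) * (real k * b ^ (k - 1)) \<le> (a - b) * (\<Sum>i<k. b ^ (k - Suc i) * a ^ i)"
    using assms by (intro mult_left_mono) auto
  then show ?thesis by (simp add: power_diff_sumr2 mult_ac)
qed

lemma four_mult_one_minus_sqrt_sq_le: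
  assumes "0 \<le> w" "w \<le> 1"
  shows "4 * w * (1 - sqrt w)\<^sup>2 \<le> (1 - w)\<^sup>2"
proof -
  define r where "r = sqrt w"
  have r: "w = r\<^sup>2" "0 \<le> r" "r \<le> 1" using assms by (auto simp: r_def)
  have "4 * r\<^sup>2 * (1 - r)\<^sup>2 = (2 * r)\<^sup>2 * (1 - r)\<^sup>2" by (simp add: power2_eq_square)
  also have "\<dots> \<le> (1 + r)\<^sup>2 * (1 - r)\<^sup>2" using r by (intro mult_right_mono power_mono) auto
  also have "\<dots> = (1 - r\<^sup>2)\<^sup>2" by (simp add: power2_eq_square algebra_simps)
  finally show ?thesis using r by (simp add: r_def [symmetric])
qed

text \<open>\<open>W\<close> stands for sqrt (X Y). It matters that \<open>lo\<close> puts Q/P above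
  theta: the term (x - theta) B is then subtracted from a positive remainder, so the upper bound for
  the remainder also bounds the linear form.\<close>

lemma no_rational_approximation:
  fixes k :: nat and Y P Q :: int and W :: real
  assumes k: "k \<ge> 7" and Y: "Y \<ge> 2 ^ k" and PQ: "0 < Q" "Q < P"
    and W: "W > 0" "of_int P ^ k \<le> W\<^sup>2"
    and lo: "1 - 1 / of_int Y < (of_int Q / of_int P :: real) ^ k"
    and hi: "(of_int Q / of_int P) ^ k \<le> 1 - 1 / of_int Y + 2 / W"
  shows False
proof -
  define y p q where "y = real_of_int Y" and "p = real_of_int P" and "q = real_of_int Q"
  define w V \<nu> where "w = 1 - 1 / y" and "V = y - 1" and "\<nu> = 1 / real k"
  define \<theta> x where "\<theta> = w powr \<nu>" and "x = q / p"
  define \<rho> where "\<rho> = (if k \<le> 8 then 2 else if k = 9 then 3 else k)"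
  define M where "M = real k * real \<rho>"
  \<comment> \<open>The integer form loses a factor H per degree: the scaling grows by at most M y,
    while the remainder shrinks by (1 - sqrt w)^2 <= 1 / (4 y V).\<close>
  define H where "H = 4 * V / M"
  have k0: "real k \<ge> 7" using k by simp
  have \<nu>: "0 < \<nu>" "\<nu> \<le> 1 / 2" using k by (auto simp: \<nu>_def field_simps)
  have "real_of_int (2 ^ k) \<le> y" using Y unfolding y_def by (simp only: of_int_le_iff)
  then have y2k: "2 ^ k \<le> y" by simp
  have "(2::real) ^ 7 \<le> 2 ^ k" using k by (intro power_increasing) auto
  then have y: "y \<ge> 128" using y2k by simp
  have V: "V \<ge> 127" "V = y * w" using y by (auto simp: V_def w_def field_simps)
  have w: "1 / 2 \<le> w" "w < 1" "1 - w = 1 / y" using y by (auto simp: w_def field_simps)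
  have pq: "0 < q" "0 < p" "1 \<le> p - q" using PQ by (auto simp: p_def q_def)
  have x: "0 < x" "x < 1" "q = x * p" using pq by (auto simp: x_def field_simps)
  have xk: "w < x ^ k" "x ^ k \<le> w + 2 / W" using lo hi by (simp_all add: w_def x_def y_def p_def q_def)
  have \<theta>0: "\<theta> > 0" using w by (simp add: \<theta>_def)
  have \<theta>k: "\<theta> ^ k = w"
    using k w by (simp add: \<theta>_def \<nu>_def powr_realpow [symmetric] powr_powr)
  have \<theta>x: "\<theta> < x" by (rule power_less_imp_less_base[of _ k]) (use \<theta>k xk x in auto)
  have "\<theta> < 1" using \<theta>x x by simp
  have \<theta>w: "w \<le> \<theta> ^ (k - 1)"
    unfolding \<theta>k [symmetric] by (rule power_decreasing) (use \<theta>0 \<open>\<theta> < 1\<close> in auto)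
  have "real k * w * (x - \<theta>) \<le> real k * \<theta> ^ (k - 1) * (x - \<theta>)"
    using \<theta>w \<theta>x by (intro mult_right_mono mult_left_mono) auto
  also have "\<dots> \<le> x ^ k - \<theta> ^ k" using \<theta>x \<theta>0 by (intro power_diff_ge) auto
  also have "\<dots> \<le> 2 / W" using xk \<theta>k by simp
  finally have \<eta>: "real k * w * (x - \<theta>) \<le> 2 / W" .
  have "real k * w * (1 - \<theta>) \<le> real k * \<theta> ^ (k - 1) * (1 - \<theta>)"
    using \<theta>w \<open>\<theta> < 1\<close> by (intro mult_right_mono mult_left_mono) auto
  also have "\<dots> \<le> 1 ^ k - \<theta> ^ k" using \<open>\<theta> < 1\<close> \<theta>0 by (intro power_diff_ge) auto
  also have "\<dots> = 1 / y" using w \<theta>k by simp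
  finally have "y * (real k * w * (1 - \<theta>)) \<le> y * (1 / y)" using y by (intro mult_left_mono) auto
  then have \<theta>1: "real k * V * (1 - \<theta>) \<le> 1" using y by (simp add: V(2) mult_ac)
  have kV: "real k * V > 0" using k0 V(1) by simp
  have "real k * V * 1 \<le> real k * V * (p * (1 - x))"
    using pq x kV by (intro mult_left_mono) (auto simp: algebra_simps)
  also have "\<dots> < real k * V * (p * (1 - \<theta>))" using kV pq \<theta>x by (intro mult_strict_left_mono) auto
  also have "\<dots> = p * (real k * V * (1 - \<theta>))" by simp
  also have "\<dots> \<le> p * 1" using \<theta>1 pq by (intro mult_left_mono) auto
  finally have pkV: "real k * V < p" by simp
  have M: "M > 0" using k by (simp add: M_def \<rho>_def)
  have Hk: "256 * y ^ 4 \<le> H ^ k"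
    using growth_condition[OF k y2k] by (simp add: H_def M_def \<rho>_def V_def)
  have "H > 0" using M V(1) by (simp add: H_def)
  have "H > 1"
  proof (rule ccontr)
    assume "\<not> H > 1"
    then have "H ^ k \<le> 1" using \<open>H > 0\<close> by (intro power_le_one) auto
    moreover have "1 \<le> y ^ 4" using y by (intro one_le_power) auto
    ultimately show False using Hk by linarith
  qed
  \<comment> \<open>the least degree for which the integer constructed below is forced to be less than 1\<close>
  define n where "n = (LEAST n. p / (real k * V) < H ^ n)"
  have ex: "\<exists>n. p / (real k * V) < H ^ n" using real_arch_pow[OF \<open>H > 1\<close>] .
  have n1: "p / (real k * V) < H ^ n" unfolding n_def using ex by (rule LeastI_ex)
  \<comment> \<open>By \<open>pkV\<close> the threshold is missed at degree 0, so n has a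
    predecessor to which minimality applies.\<close>
  have "n \<noteq> 0" using n1 pkV kV by (intro notI) (simp add: field_simps)
  then obtain m where m: "n = Suc m" by (cases n) auto
  have "\<not> p / (real k * V) < H ^ m"
    by (rule not_less_Least) (use m in \<open>simp add: n_def\<close>)
  then have pm: "real k * V * H ^ m \<le> p" using kV by (simp add: field_simps)

  \<comment> \<open>The constant 6860 = 20 * 7^3 has to meet two demands: its square is at most 7^7
    * 127, and 6860 / 2^4 exceeds 64, which is used when y^3 is compared with w V^3.\<close>
  have e1: "(6860 * V ^ 3)\<^sup>2 = 6860\<^sup>2 * V ^ 6" by (simp add: power_mult_distrib flip: power_mult)
  have "(16 * y\<^sup>2)\<^sup>2 = 256 * y ^ 4" by (simp add: power_mult_distrib flip: power_mult)
  then have e2: "((16 * y\<^sup>2) ^ m)\<^sup>2 = (256 * y ^ 4) ^ m" by (metis power_mult mult.commute)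
  have "(6860 * V ^ 3 * (16 * y\<^sup>2) ^ m)\<^sup>2 = (6860\<^sup>2 * V ^ 6) * (256 * y ^ 4) ^ m"
    unfolding power_mult_distrib [of "6860 * V ^ 3"] e1 e2 ..
  also have "\<dots> \<le> (real k * V) ^ k * (H ^ k) ^ m"
  proof (intro mult_mono power_mono[of _ _ m] Hk)
    have "6860\<^sup>2 * V ^ 6 \<le> (7 ^ 7 * V) * V ^ 6" using V(1) by (intro mult_right_mono) auto
    also have "\<dots> = (7 * V) ^ 7" by (simp add: power_mult_distrib power_Suc [symmetric] del: power_Suc)
    also have "\<dots> \<le> (7 * V) ^ k" using V(1) k by (intro power_increasing) auto
    also have "\<dots> \<le> (real k * V) ^ k" using V(1) k0 by (intro power_mono mult_right_mono) auto
    finally show "6860\<^sup>2 * V ^ 6 \<le> (real k * V) ^ k" .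
  qed (use y kV in auto)
  also have "\<dots> = (real k * V * H ^ m) ^ k"
    by (simp add: power_mult_distrib power_mult [symmetric] mult.commute)
  also have "\<dots> \<le> p ^ k" using pm kV \<open>H > 0\<close> by (intro power_mono) auto
  also have "\<dots> \<le> W\<^sup>2" using W by (simp add: p_def)
  finally have W1: "6860 * V ^ 3 * (16 * y\<^sup>2) ^ m \<le> W"
    by (rule power2_le_imp_le) (use W in simp)

  \<comment> \<open>Minimality of \<open>n\<close> makes the gap between \<open>x\<close> and \<open>\<theta>\<close>, of order \<open>1 / W\<close>, smaller than the
    Pade remainder; so the linear form \<open>A * p - B * q\<close> keeps the sign of the remainder and
    cannot vanish.\<close>
  define C A B where "C = real (2 * n choose n)" and "A = pade n \<nu> w" and "B = pade n (-\<nu>) w"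
  have C: "C > 0" by (simp add: C_def)
  have B: "0 \<le> B" "B \<le> C"
    unfolding B_def C_def using \<nu> w by (intro pade_nonneg pade_le_central_binomial; simp)+
  have S1: "A - \<theta> * B \<le> (1 - sqrt w) ^ (2 * n) * (1 - \<theta>)"
    unfolding A_def B_def \<theta>_def using w by (intro pade_remainder_le \<nu>) auto
  have S2: "\<nu> / 2 * (1 - w) ^ (2 * n + 1) / (real (2 * n + 1) * C) \<le> A - \<theta> * B"
    unfolding A_def B_def \<theta>_def C_def using w by (intro pade_remainder_ge \<nu>) auto

  \<comment> \<open>Aim: the cross-multiplied form of the comparison between the error 2 C / (k w W)
    and the lower bound in \<open>S2\<close>; the factor 1/k cancels against nu.\<close>
  have "4 * (real (2 * n + 1) * C\<^sup>2) * y ^ (2 * n + 1) \<le> 4 * 16 ^ n * y ^ (2 * n + 1)"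
    using central_binomial_sq_le[of n] y by (intro mult_right_mono) (auto simp: C_def)
  also have "\<dots> = 64 * y ^ 3 * (16 * y\<^sup>2) ^ m"
    by (simp add: m power_mult_distrib power_mult [symmetric] power_add eval_nat_numeral)
  also have "\<dots> < w * (6860 * V ^ 3) * (16 * y\<^sup>2) ^ m"
  proof (rule mult_strict_right_mono)
    have "(1 / 2) ^ 4 \<le> w ^ 4" using w by (intro power_mono) auto
    then have "64 < 6860 * w ^ 4" by (simp add: power_divide)
    then have "64 * y ^ 3 < 6860 * w ^ 4 * y ^ 3" using y by (intro mult_strict_right_mono) auto
    then show "64 * y ^ 3 < w * (6860 * V ^ 3)"
      by (simp add: V(2) power_mult_distrib eval_nat_numeral mult_ac)
  qed (use y in auto)
  also have "\<dots> = w * (6860 * V ^ 3 * (16 * y\<^sup>2) ^ m)" by simp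
  also have "\<dots> \<le> w * W" using W1 w by (intro mult_left_mono) auto
  finally have key: "4 * (real (2 * n + 1) * C\<^sup>2) * y ^ (2 * n + 1) < w * W" .

  have "(x - \<theta>) * B \<le> (x - \<theta>) * C" using B \<theta>x by (intro mult_left_mono) auto
  also have "\<dots> \<le> 2 / (real k * w * W) * C"
  proof (rule mult_right_mono)
    show "x - \<theta> \<le> 2 / (real k * w * W)" using \<eta> k0 w W by (simp add: field_simps)
  qed (use C in simp)
  also have "\<dots> < \<nu> / 2 * (1 - w) ^ (2 * n + 1) / (real (2 * n + 1) * C)"
  proof -
    define D E where "D = real (2 * n + 1)" and "E = y ^ (2 * n + 1)"
    have DE: "D > 0" "E > 0" using y by (auto simp: D_def E_def)
    have "4 * (D * C\<^sup>2) * E < w * W" using key by (simp only: D_def E_def)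
    then have "2 / (real k * w * W) * C < 1 / real k / 2 * (1 / E) / (D * C)"
      using k0 w W C DE by (simp add: divide_simps) (simp add: power2_eq_square algebra_simps)
    then show ?thesis unfolding w(3) \<nu>_def D_def E_def by (simp add: power_one_over)
  qed
  also note S2
  finally have pos: "(x - \<theta>) * B < A - \<theta> * B" .

  have "\<exists>g::nat. g > 0 \<and> g \<le> \<rho> ^ n \<and>
     (\<forall>p. prime p \<and> p dvd k \<longrightarrow> multiplicity p (fact n :: nat) \<le> multiplicity p g)"
    unfolding \<rho>_def by (rule exists_fact_multiplier[OF k])
  then obtain g :: nat where g: "g > 0" "g \<le> \<rho> ^ n"
    and gm: "\<And>p. prime p \<Longrightarrow> p dvd k \<Longrightarrow> multiplicity p (fact n :: nat) \<le> multiplicity p g"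
    by blast
  define D where "D = real k ^ n * real g * y ^ n"
  have D: "D > 0" using k g y by (simp add: D_def)
  have Dint: "D * pade n (of_int e / real k) w \<in> \<int>" for e
    unfolding D_def w_def y_def using k g(1) y by (intro pade_clear_denominators gm) (auto simp: y_def)
  have "D * A \<in> \<int>" "D * B \<in> \<int>" using Dint[of 1] Dint[of "-1"] by (simp_all add: A_def B_def \<nu>_def)
  then have "(D * A) * p - (D * B) * q \<in> \<int>" by (simp add: p_def q_def)
  moreover have L: "(D * A) * p - (D * B) * q = D * p * (A - \<theta> * B - (x - \<theta>) * B)"
    by (simp add: x(3) algebra_simps)
  ultimately obtain L where L2: "D * p * (A - \<theta> * B - (x - \<theta>) * B) = of_int L" by (auto elim: Ints_cases)
  have "of_int L > (0::real)" unfolding L2 [symmetric] using D pq pos by simp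
  then have "1 \<le> (of_int L :: real)" by simp
  also have "of_int L \<le> D * p * ((1 - sqrt w) ^ (2 * n) * (1 - \<theta>))"
  proof -
    have "A - \<theta> * B - (x - \<theta>) * B \<le> (1 - sqrt w) ^ (2 * n) * (1 - \<theta>)"
      using S1 mult_nonneg_nonneg[of "x - \<theta>" B] \<theta>x B by linarith
    then show ?thesis unfolding L2 [symmetric] using D pq by (intro mult_left_mono) auto
  qed
  also have "\<dots> \<le> (M ^ n * y ^ n) * p * ((1 - sqrt w) ^ (2 * n) * (1 - \<theta>))"
  proof (intro mult_right_mono)
    have "real g \<le> real (\<rho> ^ n)" using g by (simp only: of_nat_le_iff)
    then have "real k ^ n * real g \<le> real k ^ n * real (\<rho> ^ n)" by (intro mult_left_mono) auto
    then show "D \<le> M ^ n * y ^ n"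
      unfolding D_def using y by (intro mult_right_mono) (auto simp: M_def power_mult_distrib)
  qed (use pq \<open>\<theta> < 1\<close> in auto)
  also have "\<dots> = (M * y * (1 - sqrt w)\<^sup>2) ^ n * (p * (1 - \<theta>))"
    by (simp add: power_mult_distrib power_mult)
  also have "\<dots> \<le> (1 / H) ^ n * (p / (real k * V))"
  proof (intro mult_mono power_mono)
    have "4 * w * (1 - sqrt w)\<^sup>2 \<le> (1 / y)\<^sup>2"
      unfolding w(3) [symmetric] using w by (intro four_mult_one_minus_sqrt_sq_le) auto
    then have "y\<^sup>2 * (4 * w * (1 - sqrt w)\<^sup>2) \<le> y\<^sup>2 * (1 / y)\<^sup>2" using y by (intro mult_left_mono) auto
    then have "4 * V * (y * (1 - sqrt w)\<^sup>2) \<le> 1" using y by (simp add: V(2) power2_eq_square mult_ac)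
    then have "M * (4 * V * (y * (1 - sqrt w)\<^sup>2)) \<le> M * 1" using M by (intro mult_left_mono) auto
    then show "M * y * (1 - sqrt w)\<^sup>2 \<le> 1 / H" using V(1) M by (simp add: H_def field_simps)
    have "1 - \<theta> \<le> 1 / (real k * V)" using \<theta>1 kV by (simp add: pos_le_divide_eq mult.commute)
    then have "p * (1 - \<theta>) \<le> p * (1 / (real k * V))" using pq by (intro mult_left_mono) auto
    then show "p * (1 - \<theta>) \<le> p / (real k * V)" by simp
  qed (use M y pq \<open>\<theta> < 1\<close> \<open>H > 0\<close> in auto)
  also have "\<dots> < (1 / H) ^ n * H ^ n" using n1 \<open>H > 0\<close> by (intro mult_strict_left_mono) auto
  also have "\<dots> = 1" using \<open>H > 0\<close> by (simp add: power_one_over)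
  finally show False by simp
qed

section \<open>From the equation to a good rational approximation\<close>

lemma no_solution_ordered:
  fixes a b c x y z :: int and k :: nat
  assumes abc: "a > 0" "b > 0" "c > 0" and k: "k \<ge> 7" and xyz: "x > 1" "y > 1" "z > 1"
    and less: "b\<^sup>2 * y ^ k < a\<^sup>2 * x ^ k"
    and eq: "(a\<^sup>2 * c * x ^ k - 1) * (b\<^sup>2 * c * y ^ k - 1) = (a * b * c * z ^ k - 1)\<^sup>2"
  shows False
proof -
  define X Y Z where "X = a\<^sup>2 * c * x ^ k" and "Y = b\<^sup>2 * c * y ^ k" and "Z = a * b * c * z ^ k"
  have "b\<^sup>2 * y ^ k * c < a\<^sup>2 * x ^ k * c" using less abc by (intro mult_strict_right_mono) auto
  then have XY: "Y < X" by (simp add: X_def Y_def mult_ac)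
  have "1 * 2 ^ k \<le> (b\<^sup>2 * c) * y ^ k"
  proof (intro mult_mono power_mono)
    have "0 < b\<^sup>2 * c" using abc by simp
    then show "1 \<le> b\<^sup>2 * c" by linarith
  qed (use xyz abc in auto)
  then have Y2: "2 ^ k \<le> Y" by (simp add: Y_def)
  have "(2::int) ^ 1 \<le> 2 ^ k" using k by (intro power_increasing) auto
  then have Y1: "Y \<ge> 2" using Y2 by simp
  have Z0: "Z > 0" using abc xyz by (simp add: Z_def)
  have eq': "(X - 1) * (Y - 1) = (Z - 1)\<^sup>2" using eq by (simp add: X_def Y_def Z_def)
  have "(Y - 1)\<^sup>2 < (X - 1) * (Y - 1)"
    unfolding power2_eq_square using XY Y1 by (intro mult_strict_right_mono) auto
  then have ZY: "Y < Z" using eq' Z0 power2_less_imp_less[of "Y - 1" "Z - 1"] by simp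
  \<comment> \<open>Strict inequality of arithmetic and geometric means for X - 1 and Y - 1, whose
    product is (Z - 1)^2.\<close>
  have "0 < (X - Y)\<^sup>2" using XY by simp
  then have "(2 * (Z - 1))\<^sup>2 < (X + Y - 2)\<^sup>2"
    using eq' by (simp add: power2_eq_square algebra_simps)
  then have sum: "2 * (Z - 1) < X + Y - 2" by (rule power2_less_imp_less) (use XY Y1 in simp)
  have prod: "X * Y = Z\<^sup>2 + (X + Y - 2 * Z)" using eq' by (simp add: power2_eq_square algebra_simps)
  then have ZXY: "Z\<^sup>2 < X * Y" using sum by simp
  \<comment> \<open>X Y and Z^2 are k-th powers times the same factor (a b c)^2, so their ratio is a
    k-th power of a rational free of a, b and c.\<close>
  define P Q where "P = x * y" and "Q = z\<^sup>2"
  have P: "X * Y = (a * b * c)\<^sup>2 * P ^ k"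
    by (simp add: X_def Y_def P_def power_mult_distrib power2_eq_square mult_ac)
  have Q: "Z\<^sup>2 = (a * b * c)\<^sup>2 * Q ^ k"
    by (simp add: Z_def Q_def power_mult_distrib power_mult [symmetric] mult.commute)
  have abc2: "(a * b * c)\<^sup>2 > 0" using abc by simp
  then have "Q ^ k < P ^ k" using ZXY unfolding P Q by simp
  moreover have "0 < P" "0 < Q" using xyz by (simp_all add: P_def Q_def)
  ultimately have QP: "Q < P" using power_less_imp_less_base[of Q k P] by simp
  define W where "W = sqrt (of_int (X * Y))"
  have X0: "X > 0" using XY Y1 by simp
  then have XY0: "X * Y > 0" using Y1 by simp
  have XYr: "0 < real_of_int (X * Y)" using XY0 by (simp only: of_int_0_less_iff)
  have W2: "W\<^sup>2 = of_int (X * Y)" unfolding W_def using XYr by (intro real_sqrt_pow2 less_imp_le)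
  have W0: "W > 0" unfolding W_def using XYr by (simp only: real_sqrt_gt_0_iff)
  have "1 * P ^ k \<le> X * Y" unfolding P by (intro mult_right_mono) (use abc2 \<open>0 < P\<close> in \<open>linarith | simp\<close>)+
  then have PW: "of_int P ^ k \<le> W\<^sup>2" unfolding W2 by (metis mult_1 of_int_le_iff of_int_power)
  have "(of_int Z)\<^sup>2 \<le> W\<^sup>2" unfolding W2 using ZXY by (metis less_imp_le of_int_le_iff of_int_power)
  then have ZW: "of_int Z \<le> W" by (rule power2_le_imp_le) (use W0 in simp)
  have "(of_int Q / of_int P) ^ k = (of_int (Q ^ k) / of_int (P ^ k) :: real)" by (simp add: power_divide)
  also have "\<dots> = of_int ((a * b * c)\<^sup>2 * Q ^ k) / of_int ((a * b * c)\<^sup>2 * P ^ k)"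
    using abc by simp
  also have "\<dots> = of_int (Z\<^sup>2) / of_int (X * Y)" by (simp only: P Q)
  also have "Z\<^sup>2 = X * Y - X + (2 * Z - Y)" using prod by simp
  also have "of_int (X * Y - X + (2 * Z - Y)) / of_int (X * Y)
     = (1 - 1 / of_int Y + of_int (2 * Z - Y) / of_int (X * Y) :: real)"
    using X0 Y1 by (simp add: field_simps)
  finally have ratio: "(of_int Q / of_int P) ^ k = (1 - 1 / of_int Y + of_int (2 * Z - Y) / of_int (X * Y) :: real)" .
  show False
  proof (rule no_rational_approximation[OF k Y2 \<open>0 < Q\<close> QP W0 PW])
    have "0 < (of_int (2 * Z - Y) / of_int (X * Y) :: real)"
      using ZY Z0 XY0 by (intro divide_pos_pos) (simp_all only: of_int_0_less_iff)
    then show "1 - 1 / of_int Y < (of_int Q / of_int P :: real) ^ k" unfolding ratio by simp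
    have "of_int (2 * Z - Y) / W\<^sup>2 \<le> 2 * W / W\<^sup>2"
      using ZW Y1 by (intro divide_right_mono) auto
    then have "of_int (2 * Z - Y) / of_int (X * Y) \<le> 2 / W"
      unfolding W2 [symmetric] using W0 by (simp add: power2_eq_square)
    then show "(of_int Q / of_int P) ^ k \<le> 1 - 1 / of_int Y + 2 / W" unfolding ratio by simp
  qed
qed

theorem theorem1:
  fixes a b c :: int and k :: nat
  assumes "a > 0" and "b > 0" and "c > 0" and "k \<ge> 7"
  shows "\<not> (\<exists>x y z :: int. x > 1 \<and> y > 1 \<and> z > 1 \<and> a\<^sup>2 * x ^ k \<noteq> b\<^sup>2 * y ^ k \<and>
           (a\<^sup>2 * c * x ^ k - 1) * (b\<^sup>2 * c * y ^ k - 1) = (a * b * c * z ^ k - 1)\<^sup>2)"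
proof (intro notI, elim exE conjE)
  fix x y z :: int
  assume xyz: "x > 1" "y > 1" "z > 1" and ne: "a\<^sup>2 * x ^ k \<noteq> b\<^sup>2 * y ^ k"
    and eq: "(a\<^sup>2 * c * x ^ k - 1) * (b\<^sup>2 * c * y ^ k - 1) = (a * b * c * z ^ k - 1)\<^sup>2"
  from ne consider "b\<^sup>2 * y ^ k < a\<^sup>2 * x ^ k" | "a\<^sup>2 * x ^ k < b\<^sup>2 * y ^ k" by linarith
  then show False
  proof cases
    case 1
    then show ?thesis using no_solution_ordered[of a b c k x y z] assms xyz eq by blast
  next
    case 2
    have "(b\<^sup>2 * c * y ^ k - 1) * (a\<^sup>2 * c * x ^ k - 1) = (b * a * c * z ^ k - 1)\<^sup>2"
      using eq by (simp only: mult.commute [of b a] mult.commute [of "b\<^sup>2 * c * y ^ k - 1"])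
    then show ?thesis using no_solution_ordered[of b a c k y x z] assms xyz 2 by blast
  qed
qed

end
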